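(* Let $(z_k)_{k\ge 0}$ be the sequence generated by the fOGDA-VI algorithm (described in the context) for the monotone $L$-Lipschitz operator $F:\mathbb{R}^d\to\mathbb{R}^d$ and the nonempty closed convex set $C\subseteq\mathbb{R}^d$, with $\alpha>2$ and $0<\gamma<\frac{1}{4L}$, where the solution set $\Omega$ is nonempty. Then $(z_k)_{k\ge 0}$ converges to a solution of the variational inequality, i.e. to some $z^\ast\in C$ with $\langle F(z^\ast), z-z^\ast\rangle\ge 0$ for all $z\in C$.
   Context: $\mathbb{R}^d$ carries its standard inner product $\langle\cdot,\cdot\rangle$ and induced norm $\|\cdot\|$. $F:\mathbb{R}^d\to\mathbb{R}^d$ is monotone, i.e. $\langle F(w)-F(z),w-z\rangle\ge 0$ for all $w,z$, and $L$-Lipschitz continuous with $L>0$, i.e. $\|F(w)-F(z)\|\le L\|w-z\|$ for all $w,z$. $C\subseteq\mathbb{R}^d$ is nonempty, closed and convex; $P_C$ is the projection onto $C$; $N_C(z)=\{w\in\mathbb{R}^d : \langle v-z,w\rangle\le 0\ \forall v\in C\}$ for $z\in C$ and $N_C(z)=\emptyset$ for $z\notin C$. The solution set $\Omega=\{z^\ast\in C : \langle F(z^\ast),z-z^\ast\rangle\ge 0\ \forall z\in C\}$ is assumed nonempty. Algorithm fOGDA-VI: Choose $\alpha>2$, $0<\gamma<\frac{1}{4L}$, $z_0,w_0\in\mathbb{R}^d$, $z_1\in C$, $\zeta_1\in N_C(z_1)$. For every $k\ge 1$ compute $$w_k = z_k+\frac{k}{k+\alpha}(z_k-z_{k-1})-\gamma\frac{\alpha}{k+\alpha}\bigl(F(w_{k-1})+\zeta_k\bigr),$$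 $$z_{k+1}=P_C\Bigl[w_k-\gamma\Bigl(1+\frac{k}{k+\alpha}\Bigr)\bigl(F(w_k)-F(w_{k-1})-\zeta_k\bigr)\Bigr],$$ $$\zeta_{k+1}=\frac{k+\alpha}{\gamma(2k+\alpha)}(w_k-z_{k+1})-\bigl(F(w_k)-F(w_{k-1})-\zeta_k\bigr).$$ *)

theory Defs
  imports "HOL-Analysis.Analysis"
begin

text \<open>Monotonicity in the sense of operator theory; unrelated to the order-theoretic
  \<open>mono\<close> and \<open>monotone\<close> of HOL.\<close>

definition monotone_operator :: "('a::real_inner \<Rightarrow> 'a) \<Rightarrow> bool" where
  "monotone_operator F \<longleftrightarrow> (\<forall>w z. (F w - F z) \<bullet> (w - z) \<ge> 0)"

definition normal_cone :: "'a::real_inner set \<Rightarrow> 'a \<Rightarrow> 'a set" where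
  "normal_cone C z = (if z \<in> C then {w. \<forall>v\<in>C. (v - z) \<bullet> w \<le> 0} else {})"

definition VI_solutions :: "('a::real_inner \<Rightarrow> 'a) \<Rightarrow> 'a set \<Rightarrow> 'a set" where
  "VI_solutions F C = {zs \<in> C. \<forall>z\<in>C. F zs \<bullet> (z - zs) \<ge> 0}"

text \<open>The sequences \<open>z\<close>, \<open>w\<close> are indexed from \<open>0\<close> and \<open>\<zeta>\<close> from \<open>1\<close>: the points \<open>z 0\<close> and \<open>w 0\<close>
  are arbitrary, and the value \<open>\<zeta> 0\<close> is never used. The projection onto \<open>C\<close> is \<^const>\<open>closest_point\<close>,
  which is the metric projection when \<open>C\<close> is nonempty, closed and convex.\<close>

definition fOGDA_VI ::
  "('a::euclidean_space \<Rightarrow> 'a) \<Rightarrow> 'a set \<Rightarrow> real \<Rightarrow> real \<Rightarrow>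
    (nat \<Rightarrow> 'a) \<Rightarrow> (nat \<Rightarrow> 'a) \<Rightarrow> (nat \<Rightarrow> 'a) \<Rightarrow> bool" where
  "fOGDA_VI F C \<alpha> \<gamma> z w \<zeta> \<longleftrightarrow>
    z 1 \<in> C \<and> \<zeta> 1 \<in> normal_cone C (z 1) \<and>
    (\<forall>k\<ge>1.
      w k = z k + (real k / (real k + \<alpha>)) *\<^sub>R (z k - z (k - 1))
              - (\<gamma> * (\<alpha> / (real k + \<alpha>))) *\<^sub>R (F (w (k - 1)) + \<zeta> k) \<and>
      z (k + 1) = closest_point C
              (w k - (\<gamma> * (1 + real k / (real k + \<alpha>))) *\<^sub>R (F (w k) - F (w (k - 1)) - \<zeta> k)) \<and>
      \<zeta> (k + 1) = ((real k + \<alpha>) / (\<gamma> * (2 * real k + \<alpha>))) *\<^sub>R (w k - z (k + 1))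
              - (F (w k) - F (w (k - 1)) - \<zeta> k))"

end

theory Submission
  imports Defs
begin

text \<open>
  Put \<open>V\<^sub>k = \<gamma> (F w\<^sub>k\<^sub>-\<^sub>1 + \<zeta>\<^sub>k)\<close>, \<open>d\<^sub>k = z\<^sub>k - z\<^sub>k\<^sub>-\<^sub>1\<close> and \<open>D\<^sub>k = V\<^sub>k - V\<^sub>k\<^sub>-\<^sub>1\<close>. The algorithm becomes the inertial scheme
  \<open>(k + \<alpha>) d\<^sub>k\<^sub>+\<^sub>1 = k d\<^sub>k - \<alpha> V\<^sub>k\<^sub>+\<^sub>1 - 2 k D\<^sub>k\<^sub>+\<^sub>1\<close>, in which \<open>V\<^sub>k\<close> differs from the element \<open>\<gamma> (F z\<^sub>k + \<zeta>\<^sub>k)\<close> of the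
  monotone operator \<open>\<gamma> (F + N\<^sub>C)\<close> by an error \<open>e\<^sub>k\<close> with \<open>\<parallel>e\<^sub>k\<parallel> \<le> \<eta> \<parallel>D\<^sub>k\<parallel>\<close> and \<open>\<eta> = 2 L \<gamma> < 1/2\<close>.
  For every solution \<open>p\<close> and every \<open>\<theta>\<close> strictly between \<open>1\<close> and \<open>\<alpha> - 1\<close> there is an energy, affine in \<open>\<theta>\<close>, that
  dominates \<open>\<parallel>z\<^sub>k - p\<parallel>\<^sup>2\<close> and decreases up to a factor \<open>1 + O(k\<^sup>-\<^sup>2)\<close>. Its dissipation makes
  \<open>k \<parallel>d\<^sub>k\<parallel>\<^sup>2\<close>, \<open>k \<parallel>V\<^sub>k\<parallel>\<^sup>2\<close> and \<open>k\<^sup>2 \<parallel>D\<^sub>k\<parallel>\<^sup>2\<close> summable. Comparing two values of \<open>\<theta>\<close> shows that the coefficient of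
  \<open>\<theta>\<close> converges, which forces \<open>\<parallel>z\<^sub>k - p\<parallel>\<close> to converge. Cluster points are solutions because \<open>V\<^sub>k\<close> and
  \<open>e\<^sub>k\<close> tend to \<open>0\<close>, and Opial's argument concludes.
\<close>

section \<open>Energies and their one-step decrease\<close>

text \<open>The \<theta>-dependent part of the energy, kept apart so that energies for two values of
  \<theta> can be subtracted. With \<open>y\<close> = k d_k and q_k = |z_k - p|^2, the first two
  terms equal (\<alpha> - 1) q_k + k (q_k - q_(k-1)) + k |d_k|^2.\<close>

definition anchored_energy :: "real \<Rightarrow> real \<Rightarrow> 'a::real_inner \<Rightarrow> 'a \<Rightarrow> 'a \<Rightarrow> real" where
  "anchored_energy \<alpha> k x y v = (\<alpha> - 1) * (x \<bullet> x) + 2 * (x \<bullet> y) + 4 * k * (x \<bullet> v)"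

text \<open>In the energies below \<open>x = z\<^sub>k - p\<close> and \<open>y = k d\<^sub>k\<close>. The inner product \<open>y \<bullet> e\<close> is what remains
  when the error part of \<open>d\<^sub>k\<^sub>+\<^sub>1 \<bullet> D\<^sub>k\<^sub>+\<^sub>1\<close> telescopes; the last summand pays for the leftover
  \<open>D\<^sub>k\<^sub>+\<^sub>1 \<bullet> e\<^sub>k\<close>, its coefficient \<open>2\<close> lying between \<open>4 \<eta>\<close> and \<open>4 - 4 \<eta>\<close> because \<open>\<eta> < 1/2\<close>.\<close>

definition velocity_energy ::
  "real \<Rightarrow> real \<Rightarrow> 'a::real_inner \<Rightarrow> 'a \<Rightarrow> 'a \<Rightarrow> 'a \<Rightarrow> real" where
  "velocity_energy \<alpha> k y v e D =
     2 * ((y + k *\<^sub>R v) \<bullet> (y + k *\<^sub>R v)) + 2 * k * (k + \<alpha>) * (v \<bullet> v)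
     + 4 * k * (y \<bullet> e) + 2 * k\<^sup>2 * (D \<bullet> D)"

definition energy ::
  "real \<Rightarrow> real \<Rightarrow> real \<Rightarrow> 'a::real_inner \<Rightarrow> 'a \<Rightarrow> 'a \<Rightarrow> 'a \<Rightarrow> 'a \<Rightarrow> real" where
  "energy \<alpha> \<theta> k x y v e D = 2 * \<theta> * anchored_energy \<alpha> k x y v + velocity_energy \<alpha> k y v e D"

text \<open>Here \<open>d\<close>, \<open>v\<close>, \<open>e1\<close> belong to step k+1 and
  \<open>v0\<close>, \<open>e0\<close>, \<open>D0\<close> to step k. The recursion expresses
  \<open>y\<close> through the new quantities, so the difference is pure algebra. The right side is
  sorted by later use: the gap, a quadratic form in \<open>d\<close> and \<open>v\<close>, the
  monotonicity product, error terms, and the increments of V.\<close>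

lemma energy_step_identity:
  fixes x d v v0 y e0 e1 D0 :: "'a::real_inner" and k \<alpha> \<theta> :: real
  assumes y: "y = (k + \<alpha>) *\<^sub>R d + \<alpha> *\<^sub>R v + (2 * k) *\<^sub>R (v - v0)"
  defines "\<mu> \<equiv> \<alpha> - 1 - \<theta>"
  shows "energy \<alpha> \<theta> (k + 1) x ((k + 1) *\<^sub>R d) v e1 (v - v0) - energy \<alpha> \<theta> k (x - d) y v0 e0 D0
    = - 4 * \<theta> * (\<alpha> - 2) * (x \<bullet> v)
      - 2 * \<mu> * (2 * k + \<alpha> + 1) * (d \<bullet> d)
      - (8 * \<mu> * k + 4 * (\<alpha> - 1 + \<mu> * \<alpha>)) * (d \<bullet> v)
      - 2 * (\<alpha> - 2) * (2 * k + \<alpha> + 1) * (v \<bullet> v)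
      - 4 * k * (k + \<alpha>) * (d \<bullet> ((v - e1) - (v0 - e0)))
      + 4 * ((2 - \<alpha>) * k + 1) * (d \<bullet> e1)
      - 4 * k * \<alpha> * (v \<bullet> e0) - 8 * k\<^sup>2 * ((v - v0) \<bullet> e0)
      - (2 * k * (2 * k + \<alpha>) - 2 * (k + 1)\<^sup>2) * ((v - v0) \<bullet> (v - v0))
      - 2 * k\<^sup>2 * (D0 \<bullet> D0)"
  unfolding y \<mu>_def energy_def anchored_energy_def velocity_energy_def
  by (simp add: inner_simps inner_commute algebra_simps power2_eq_square)

text \<open>Serves twice: it makes the energy nonnegative, and it lets a small multiple of |x|^2 be
  absorbed by the energy itself.\<close>

lemma energy_lower_bound:
  fixes x y v e D :: "'a::real_inner"
  assumes "k \<ge> 0" "\<alpha> \<ge> 0" "\<theta> \<ge> 0" "norm e \<le> norm D / 2" "x \<bullet> (v - e) \<ge> 0"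
  shows "energy \<alpha> \<theta> k x y v e D \<ge> 2 * \<theta> * (\<alpha> - 1 - \<theta>) * (norm x)\<^sup>2"
proof -
  \<comment> \<open>Completing the squares with \<open>e\<close> inside makes the indefinite terms in \<open>x \<bullet> e\<close> cancel.\<close>
  let ?p = "(2 * \<theta>) *\<^sub>R x + 2 *\<^sub>R y + (2 * k) *\<^sub>R v + (2 * k) *\<^sub>R e"
  have id: "energy \<alpha> \<theta> k x y v e D = 2 * \<theta> * (\<alpha> - 1 - \<theta>) * (x \<bullet> x)
      + ?p \<bullet> ?p / 2 + 2 * k\<^sup>2 * ((v - e) \<bullet> (v - e)) + 2 * k * \<alpha> * (v \<bullet> v)
      + 4 * \<theta> * k * (x \<bullet> (v - e)) + k\<^sup>2 * (2 * (D \<bullet> D) - 4 * (e \<bullet> e))"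
    unfolding energy_def anchored_energy_def velocity_energy_def
    by (simp add: inner_simps inner_commute algebra_simps power2_eq_square)
  have "(norm e)\<^sup>2 \<le> (norm D / 2)\<^sup>2"
    using assms by (intro power_mono) auto
  then have "4 * (norm e)\<^sup>2 \<le> (norm D)\<^sup>2"
    by (simp add: power_divide)
  with zero_le_power2[of "norm D"] have "2 * (D \<bullet> D) - 4 * (e \<bullet> e) \<ge> 0"
    unfolding power2_norm_eq_inner by linarith
  then show ?thesis
    unfolding id using assms by (simp flip: power2_norm_eq_inner add: inner_commute)
qed

lemma weighted_am_gm:
  fixes p q c :: real
  assumes "c > 0"
  shows "2 * p * q \<le> c * p\<^sup>2 + q\<^sup>2 / c"
proof -
  have "0 \<le> (c * p - q)\<^sup>2 / c"
    using assms by simp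
  also have "\<dots> = c * p\<^sup>2 + q\<^sup>2 / c - 2 * p * q"
    using assms by (simp add: field_simps power2_eq_square)
  finally show ?thesis by simp
qed

text \<open>The monotonicity product has a good sign and is dropped; Young's inequality charges the
  error terms to the negative squares. Of the m k (|d|^2 + |v|^2) available, \<open>de\<close> and
  \<open>ve\<close> each spend a third of one summand. Of the \<delta> k^2 |v - v0|^2 available, a
  quarter goes to \<open>xv\<close> and a quarter to \<open>ff\<close>. Only a term of order k^(-2)
  |x|^2 survives.\<close>

lemma energy_step:
  fixes x d v v0 y e0 e1 D0 :: "'a::real_inner" and k \<alpha> \<theta> \<eta> m \<delta> :: real
  assumes y: "y = (k + \<alpha>) *\<^sub>R d + \<alpha> *\<^sub>R v + (2 * k) *\<^sub>R (v - v0)"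
  defines "\<mu> \<equiv> \<alpha> - 1 - \<theta>"
  assumes \<alpha>: "\<alpha> > 2" and m: "0 < m" "m \<le> \<mu>" "m \<le> \<theta> - 1"
    and \<eta>: "0 \<le> \<eta>" and \<delta>: "0 < \<delta>" "\<delta> = 2 - 4 * \<eta>"
    and e1: "norm e1 \<le> \<eta> * norm (v - v0)" and e0: "norm e0 \<le> \<eta> * norm D0"
    and mono: "d \<bullet> ((v - e1) - (v0 - e0)) \<ge> 0"
    and k: "k \<ge> 1" "2 * (\<alpha> - 1 + \<mu> * \<alpha>) \<le> m / 3 * k" "2 + 3 * \<alpha>\<^sup>2 / m * k \<le> \<delta> / 4 * k\<^sup>2"
  shows "energy \<alpha> \<theta> (k + 1) x ((k + 1) *\<^sub>R d) v e1 (v - v0)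
    \<le> energy \<alpha> \<theta> k (x - d) y v0 e0 D0
      - (4 * \<theta> * (\<alpha> - 2) * (x \<bullet> (v - e1)) + 2 / 3 * m * k * ((norm d)\<^sup>2 + (norm v)\<^sup>2)
         + \<delta> / 2 * k\<^sup>2 * (norm (v - v0))\<^sup>2)
      + 4 * \<theta>\<^sup>2 * (\<alpha> - 2)\<^sup>2 / \<delta> / k\<^sup>2 * (norm x)\<^sup>2"
proof -
  define a b f g h where "a = norm d" and "b = norm v" and "f = norm (v - v0)"
    and "g = norm D0" and "h = norm x"
  have nn: "a \<ge> 0" "b \<ge> 0" "f \<ge> 0" "g \<ge> 0" "h \<ge> 0"
    by (simp_all add: a_def b_def f_def g_def h_def)
  have \<theta>: "\<theta> > 1" and \<mu>: "\<mu> > 0" and \<mu>\<theta>: "\<alpha> - 2 - \<mu> = \<theta> - 1" and \<eta>2: "\<eta> \<le> 1 / 2"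
    using m \<delta> by (auto simp: \<mu>_def)
  have e1': "norm e1 \<le> f / 2"
    using e1 mult_right_mono[OF \<eta>2 nn(3)] by (simp add: f_def)
  have e0': "norm e0 \<le> g / 2"
    using e0 mult_right_mono[OF \<eta>2 nn(4)] by (simp add: g_def)
  have quad: "- 2 * \<mu> * (2 * k + \<alpha> + 1) * (d \<bullet> d)
      - (8 * \<mu> * k + 4 * (\<alpha> - 1 + \<mu> * \<alpha>)) * (d \<bullet> v)
      - 2 * (\<alpha> - 2) * (2 * k + \<alpha> + 1) * (v \<bullet> v) \<le> - m * k * (a\<^sup>2 + b\<^sup>2)"
  proof -
    \<comment> \<open>The constant 1/3 lies below (3 - sqrt 5)/2, the smallest eigenvalue of this
      quadratic form.\<close>
    have "(1 / 3) * (d \<bullet> d + v \<bullet> v) \<le> (d + v) \<bullet> (d + v) + v \<bullet> v"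
    proof -
      let ?q = "d + (3 / 2) *\<^sub>R v"
      have "(d + v) \<bullet> (d + v) + v \<bullet> v - (1 / 3) * (d \<bullet> d + v \<bullet> v)
          = 2 / 3 * (?q \<bullet> ?q) + 1 / 6 * (v \<bullet> v)"
        by (simp add: inner_simps inner_commute algebra_simps)
      moreover have "2 / 3 * (?q \<bullet> ?q) + 1 / 6 * (v \<bullet> v) \<ge> 0" by simp
      ultimately show ?thesis by linarith
    qed
    then have "m * ((1 / 3) * (d \<bullet> d + v \<bullet> v)) \<le> m * ((d + v) \<bullet> (d + v) + v \<bullet> v)"
      using m by (intro mult_left_mono) auto
    also have "\<dots> \<le> \<mu> * ((d + v) \<bullet> (d + v)) + (\<theta> - 1) * (v \<bullet> v)"
      using m by (simp add: distrib_left add_mono mult_right_mono)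
    finally have "(4 * k) * (m * ((1 / 3) * (d \<bullet> d + v \<bullet> v)))
        \<le> (4 * k) * (\<mu> * ((d + v) \<bullet> (d + v)) + (\<theta> - 1) * (v \<bullet> v))"
      using k by (intro mult_left_mono) auto
    then have main: "4 / 3 * m * k * (a\<^sup>2 + b\<^sup>2)
        \<le> 4 * k * (\<mu> * ((d + v) \<bullet> (d + v)) + (\<theta> - 1) * (v \<bullet> v))"
      by (simp add: a_def b_def power2_norm_eq_inner)
    have "- (d \<bullet> v) \<le> a * b"
      using Cauchy_Schwarz_ineq2[of d v] by (simp add: a_def b_def)
    also have "\<dots> \<le> (a\<^sup>2 + b\<^sup>2) / 2"
      using weighted_am_gm[of 1 a b] by simp
    finally have "(4 * (\<alpha> - 1 + \<mu> * \<alpha>)) * - (d \<bullet> v)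
        \<le> (4 * (\<alpha> - 1 + \<mu> * \<alpha>)) * ((a\<^sup>2 + b\<^sup>2) / 2)"
      using \<alpha> \<mu> by (intro mult_left_mono) auto
    also have "\<dots> = 2 * (\<alpha> - 1 + \<mu> * \<alpha>) * (a\<^sup>2 + b\<^sup>2)" by simp
    also have "\<dots> \<le> m / 3 * k * (a\<^sup>2 + b\<^sup>2)"
      by (rule mult_right_mono[OF k(2)]) simp
    finally have cross: "- ((4 * (\<alpha> - 1 + \<mu> * \<alpha>)) * (d \<bullet> v)) \<le> m / 3 * k * (a\<^sup>2 + b\<^sup>2)"
      unfolding mult_minus_right .
    \<comment> \<open>To leading order in \<open>k\<close> the form is a sum of two squares with
      weights \<mu> and \<alpha> - 2 - \<mu> = \<theta> - 1; this is why \<theta> must lie strictly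
      between 1 and \<alpha> - 1.\<close>
    have "- 2 * \<mu> * (2 * k + \<alpha> + 1) * (d \<bullet> d)
      - (8 * \<mu> * k + 4 * (\<alpha> - 1 + \<mu> * \<alpha>)) * (d \<bullet> v)
      - 2 * (\<alpha> - 2) * (2 * k + \<alpha> + 1) * (v \<bullet> v)
      = - (4 * k * (\<mu> * ((d + v) \<bullet> (d + v)) + (\<alpha> - 2 - \<mu>) * (v \<bullet> v)))
        - ((4 * (\<alpha> - 1 + \<mu> * \<alpha>)) * (d \<bullet> v))
        - 2 * \<mu> * (\<alpha> + 1) * (d \<bullet> d) - 2 * (\<alpha> - 2) * (\<alpha> + 1) * (v \<bullet> v)"
      by (simp add: inner_simps inner_commute algebra_simps)
    moreover have "2 * \<mu> * (\<alpha> + 1) * (d \<bullet> d) \<ge> 0" "2 * (\<alpha> - 2) * (\<alpha> + 1) * (v \<bullet> v) \<ge> 0"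
      using \<alpha> \<mu> by simp_all
    ultimately show ?thesis
      using main cross unfolding \<mu>\<theta> by linarith
  qed
  \<comment> \<open>Passing from \<open>v\<close> to \<open>v - e1\<close> costs x \<bullet> e1.
    Weighting Young's inequality by k^2 leaves |x|^2 with a coefficient of order k^(-2), which is
    summable.\<close>
  have xv: "- 4 * \<theta> * (\<alpha> - 2) * (x \<bullet> v)
      \<le> - 4 * \<theta> * (\<alpha> - 2) * (x \<bullet> (v - e1)) + \<delta> / 4 * k\<^sup>2 * f\<^sup>2
        + 4 * \<theta>\<^sup>2 * (\<alpha> - 2)\<^sup>2 / \<delta> / k\<^sup>2 * h\<^sup>2"
  proof -
    have "- (x \<bullet> e1) \<le> h * norm e1"
      using Cauchy_Schwarz_ineq2[of x e1] by (simp add: h_def)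
    also have "\<dots> \<le> h * (f / 2)"
      by (rule mult_left_mono[OF e1' nn(5)])
    finally have "4 * \<theta> * (\<alpha> - 2) * - (x \<bullet> e1) \<le> 4 * \<theta> * (\<alpha> - 2) * (h * (f / 2))"
      using \<theta> \<alpha> by (intro mult_left_mono) auto
    also have "\<dots> = 2 * f * (\<theta> * (\<alpha> - 2) * h)" by simp
    also have "\<dots> \<le> \<delta> / 4 * k\<^sup>2 * f\<^sup>2 + (\<theta> * (\<alpha> - 2) * h)\<^sup>2 / (\<delta> / 4 * k\<^sup>2)"
      using \<delta> k by (intro weighted_am_gm) auto
    also have "(\<theta> * (\<alpha> - 2) * h)\<^sup>2 / (\<delta> / 4 * k\<^sup>2) = 4 * \<theta>\<^sup>2 * (\<alpha> - 2)\<^sup>2 / \<delta> / k\<^sup>2 * h\<^sup>2"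
      by (simp add: power_mult_distrib)
    finally show ?thesis by (simp add: inner_simps algebra_simps)
  qed
  have c3: "k * (2 * (a * \<alpha> * f)) \<le> m / 3 * k * a\<^sup>2 + 3 * \<alpha>\<^sup>2 / m * k * f\<^sup>2" for a f
  proof -
    have "2 * a * (\<alpha> * f) \<le> m / 3 * a\<^sup>2 + (\<alpha> * f)\<^sup>2 / (m / 3)"
      using m by (intro weighted_am_gm) auto
    then have "k * (2 * a * (\<alpha> * f)) \<le> k * (m / 3 * a\<^sup>2 + (\<alpha> * f)\<^sup>2 / (m / 3))"
      using k by (intro mult_left_mono) auto
    then show ?thesis by (simp add: power_mult_distrib algebra_simps)
  qed
  have de: "4 * ((2 - \<alpha>) * k + 1) * (d \<bullet> e1) \<le> m / 3 * k * a\<^sup>2 + 3 * \<alpha>\<^sup>2 / m * k * f\<^sup>2"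
  proof -
    have "\<bar>(2 - \<alpha>) * k + 1\<bar> \<le> \<alpha> * k"
    proof -
      have "(\<alpha> - 1) * k \<ge> 1 * 1" using \<alpha> k by (intro mult_mono) auto
      then show ?thesis using k by (simp add: abs_le_iff algebra_simps)
    qed
    moreover have "\<bar>d \<bullet> e1\<bar> \<le> a * (f / 2)"
      using Cauchy_Schwarz_ineq2[of d e1] mult_left_mono[OF e1' nn(1)] by (simp add: a_def)
    ultimately have "\<bar>(2 - \<alpha>) * k + 1\<bar> * \<bar>d \<bullet> e1\<bar> \<le> (\<alpha> * k) * (a * (f / 2))"
      using \<alpha> k by (intro mult_mono) auto
    then have "4 * (((2 - \<alpha>) * k + 1) * (d \<bullet> e1)) \<le> 4 * ((\<alpha> * k) * (a * (f / 2)))"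
      using abs_ge_self[of "((2 - \<alpha>) * k + 1) * (d \<bullet> e1)"] unfolding abs_mult by linarith
    with c3[of a f] show ?thesis by (simp add: algebra_simps)
  qed
  have ve: "- 4 * k * \<alpha> * (v \<bullet> e0) \<le> m / 3 * k * b\<^sup>2 + 3 * \<alpha>\<^sup>2 / m * k * g\<^sup>2"
  proof -
    have "- (v \<bullet> e0) \<le> b * (g / 2)"
      using Cauchy_Schwarz_ineq2[of v e0] mult_left_mono[OF e0' nn(2)] by (simp add: b_def)
    then have "4 * k * \<alpha> * - (v \<bullet> e0) \<le> 4 * k * \<alpha> * (b * (g / 2))"
      using \<alpha> k by (intro mult_left_mono) auto
    with c3[of b g] show ?thesis by (simp add: algebra_simps)
  qed
  \<comment> \<open>The critical error term: it has the same order k^2 as the squares that absorb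
    it. Since 4 \<eta> = 2 - \<delta> < 2, the net \<open>-2 k^2\<close> on |v - v0|^2 (from
    \<open>DD\<close>) and on |D0|^2 suffices.\<close>
  have De: "- 8 * k\<^sup>2 * ((v - v0) \<bullet> e0) \<le> (2 - \<delta>) * k\<^sup>2 * (f\<^sup>2 + g\<^sup>2)"
  proof -
    have "- ((v - v0) \<bullet> e0) \<le> f * norm e0"
      using Cauchy_Schwarz_ineq2[of "v - v0" e0] by (simp add: f_def)
    also have "\<dots> \<le> f * (\<eta> * g)"
      using e0 nn by (intro mult_left_mono) (auto simp: g_def)
    also have "\<dots> = \<eta> * (f * g)" by simp
    also have "\<dots> \<le> \<eta> * ((f\<^sup>2 + g\<^sup>2) / 2)"
      using weighted_am_gm[of 1 f g] \<eta> by (intro mult_left_mono) auto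
    finally have "8 * k\<^sup>2 * - ((v - v0) \<bullet> e0) \<le> 8 * k\<^sup>2 * (\<eta> * ((f\<^sup>2 + g\<^sup>2) / 2))"
      by (intro mult_left_mono) auto
    moreover have "2 - \<delta> = 4 * \<eta>" using \<delta> by simp
    then have "(2 - \<delta>) * k\<^sup>2 * (f\<^sup>2 + g\<^sup>2) = 8 * k\<^sup>2 * (\<eta> * ((f\<^sup>2 + g\<^sup>2) / 2))"
      by (simp only:) simp
    ultimately show ?thesis by linarith
  qed
  have kk: "4 * k * (k + \<alpha>) * (d \<bullet> ((v - e1) - (v0 - e0))) \<ge> 0"
    using \<alpha> k mono by simp
  have coeff: "- (2 * k * (2 * k + \<alpha>) - 2 * (k + 1)\<^sup>2) \<le> - (2 * k\<^sup>2) + 2"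
  proof -
    have "2 * \<alpha> * k \<ge> 4 * k" using \<alpha> k by simp
    then show ?thesis by (simp add: power2_eq_square algebra_simps)
  qed
  have DD: "- (2 * k * (2 * k + \<alpha>) - 2 * (k + 1)\<^sup>2) * ((v - v0) \<bullet> (v - v0)) \<le> - (2 * k\<^sup>2) * f\<^sup>2 + 2 * f\<^sup>2"
    using mult_right_mono[OF coeff inner_ge_zero[of "v - v0"]]
    unfolding f_def power2_norm_eq_inner by (simp only: distrib_right)
  have gg: "3 * \<alpha>\<^sup>2 / m * k * g\<^sup>2 \<le> \<delta> / 4 * k\<^sup>2 * g\<^sup>2"
    using k by (intro mult_right_mono) auto
  have ff: "2 * f\<^sup>2 + 3 * \<alpha>\<^sup>2 / m * k * f\<^sup>2 \<le> \<delta> / 4 * k\<^sup>2 * f\<^sup>2"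
    using mult_right_mono[OF k(3), of "f\<^sup>2"] by (simp add: algebra_simps)
  have "\<delta> * k\<^sup>2 * g\<^sup>2 \<ge> \<delta> / 4 * k\<^sup>2 * g\<^sup>2"
    using \<delta> by (intro mult_right_mono) auto
  moreover have "(2 - \<delta>) * k\<^sup>2 * (f\<^sup>2 + g\<^sup>2)
      = 2 * k\<^sup>2 * f\<^sup>2 + 2 * k\<^sup>2 * g\<^sup>2 - \<delta> * k\<^sup>2 * f\<^sup>2 - \<delta> * k\<^sup>2 * g\<^sup>2"
    by (simp add: algebra_simps)
  moreover have "m * k * (a\<^sup>2 + b\<^sup>2) = m * k * a\<^sup>2 + m * k * b\<^sup>2"
    by (simp add: algebra_simps)
  moreover have "2 * k\<^sup>2 * (D0 \<bullet> D0) = 2 * k\<^sup>2 * g\<^sup>2"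
    by (simp add: g_def power2_norm_eq_inner)
  ultimately show ?thesis
    using energy_step_identity[OF y, of \<theta> x e1 e0 D0, folded \<mu>_def]
      quad xv de ve De kk DD gg ff
    unfolding a_def[symmetric] b_def[symmetric] f_def[symmetric] h_def[symmetric]
    by linarith
qed

section \<open>Convergence lemmas for real sequences\<close>

lemma convergent_summable_of_decrease:
  fixes H b :: "nat \<Rightarrow> real"
  assumes dec: "\<And>k. k \<ge> K \<Longrightarrow> H (Suc k) \<le> H k - b k"
    and b: "\<And>k. k \<ge> K \<Longrightarrow> b k \<ge> 0" and H: "\<And>k. k \<ge> K \<Longrightarrow> H k \<ge> 0"
  shows "convergent H \<and> summable b"
proof
  let ?H = "\<lambda>k. H (k + K)" and ?b = "\<lambda>k. b (k + K)"
  have step: "?b k \<le> ?H k - ?H (Suc k)" for k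
    using dec[of "k + K"] by simp
  have "decseq ?H"
    using dec b by (intro decseq_SucI) (smt (verit) add_Suc le_add2)
  moreover have "bdd_below (range ?H)"
    using H by (intro bdd_belowI2[of _ 0]) auto
  ultimately have conv: "convergent ?H"
    by (metis convergent_def LIMSEQ_decseq_INF)
  then show "convergent H"
    by (metis convergent_def LIMSEQ_offset)
  then obtain l where l: "?H \<longlonglongrightarrow> l"
    using conv by (auto simp: convergent_def)
  have "summable (\<lambda>k. ?H k - ?H (Suc k))"
    using telescope_sums'[OF l] by (rule sums_summable)
  then have "summable ?b"
    by (rule summable_comparison_test'[where N = 0]) (use step b in auto)
  then show "summable b"
    by (simp only: summable_iff_shift)
qed

lemma convergent_summable_of_almost_decrease:
  fixes G b :: "nat \<Rightarrow> real"
  assumes dec: "\<And>k. k \<ge> K \<Longrightarrow> G (Suc k) \<le> G k - b k + c / (real k)\<^sup>2 * G (Suc k)"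
    and b: "\<And>k. k \<ge> K \<Longrightarrow> b k \<ge> 0" and G: "\<And>k. k \<ge> K \<Longrightarrow> G k \<ge> 0" and c: "c > 0"
  shows "convergent G \<and> summable b"
proof -
  \<comment> \<open>The weight \<open>p\<close> absorbs the perturbation: \<open>p G\<close> is eventually nonincreasing.\<close>
  define p where "p k = 1 + 4 * c / real k" for k :: nat
  define N where "N = max K (max 1 (nat \<lceil>4 * c\<rceil>))"
  have p: "p (Suc k) \<le> p k * (1 - c / (real k)\<^sup>2)" "p k \<ge> 1" if "k \<ge> N" for k
  proof -
    have k: "real k \<ge> 1" "real k \<ge> 4 * c"
      using that unfolding N_def by linarith+
    \<comment> \<open>For k at least 4 c the perturbation p_k c / k^2 is at most 2 c / k^2, and the
      constant 4 c in \<open>p\<close> makes the drop 4 c / (k (k + 1)) at least that large.\<close>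
    have "p k \<le> 2"
      using k by (simp add: p_def)
    then have "p k * (c / (real k)\<^sup>2) \<le> 2 * (c / (real k)\<^sup>2)"
      using c by (intro mult_right_mono) auto
    also have "\<dots> = 4 * c / (2 * (real k)\<^sup>2)" by simp
    also have "\<dots> \<le> 4 * c / (real k * (real k + 1))"
      using k c by (intro divide_left_mono mult_pos_pos) (auto simp: power2_eq_square algebra_simps)
    also have "\<dots> = p k - p (Suc k)"
      using k by (simp add: p_def field_simps)
    finally show "p (Suc k) \<le> p k * (1 - c / (real k)\<^sup>2)"
      by (simp add: algebra_simps)
    show "p k \<ge> 1" using c by (simp add: p_def)
  qed
  have "convergent (\<lambda>k. p k * G k) \<and> summable b"
  proof (rule convergent_summable_of_decrease[where K = N])
    fix k assume k: "k \<ge> N"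
    then have K: "k \<ge> K" "Suc k \<ge> K" by (auto simp: N_def)
    have "p (Suc k) * G (Suc k) \<le> p k * (1 - c / (real k)\<^sup>2) * G (Suc k)"
      using p[OF k] G[OF K(2)] by (intro mult_right_mono)
    also have "\<dots> = p k * (G (Suc k) - c / (real k)\<^sup>2 * G (Suc k))"
      by (simp add: algebra_simps)
    also have "\<dots> \<le> p k * (G k - b k)"
      using p[OF k] dec[OF K(1)] by (intro mult_left_mono) auto
    also have "\<dots> \<le> p k * G k - b k"
      using mult_right_mono[OF p(2)[OF k] b[OF K(1)]] by (simp add: algebra_simps)
    finally show "p (Suc k) * G (Suc k) \<le> p k * G k - b k" .
    show "b k \<ge> 0" "p k * G k \<ge> 0"
      using b[OF K(1)] G[OF K(1)] p[OF k] by auto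
  qed
  moreover have "convergent G" if conv: "convergent (\<lambda>k. p k * G k)"
  proof -
    obtain l where l: "(\<lambda>k. p k * G k) \<longlonglongrightarrow> l"
      using conv by (auto simp: convergent_def)
    have "p \<longlonglongrightarrow> 1 + 0"
      unfolding p_def by (intro tendsto_add tendsto_const lim_const_over_n)
    then have "(\<lambda>k. p k * G k / p k) \<longlonglongrightarrow> l / (1 + 0)"
      by (intro tendsto_divide l) auto
    moreover have "p k * G k / p k = G k" for k
      using c by (simp add: p_def add_nonneg_eq_0_iff)
    ultimately show ?thesis by (auto simp: convergent_def)
  qed
  ultimately show ?thesis by blast
qed

text \<open>Discrete analogue of: if a q + t q' converges as t grows, so does q. The distance to l /
  a contracts by the factor k / (a + k) up to a small error, and divergence of the harmonic series
  drives the product of these factors to 0.\<close>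

lemma convergent_of_relaxation:
  fixes q :: "nat \<Rightarrow> real"
  assumes a: "a > 0" and conv: "convergent (\<lambda>k. a * q k + real k * (q k - q (k - 1)))"
  shows "convergent q"
proof -
  obtain l where l: "(\<lambda>k. a * q k + real k * (q k - q (k - 1))) \<longlonglongrightarrow> l"
    using conv by (auto simp: convergent_def)
  have "q \<longlonglongrightarrow> l / a"
  proof (rule LIMSEQ_I)
    fix r :: real assume r: "r > 0"
    define \<epsilon> where "\<epsilon> = r / 2"
    have \<epsilon>: "\<epsilon> > 0" using r by (simp add: \<epsilon>_def)
    define s where "s k = \<bar>q k - l / a\<bar>" for k
    obtain N where N: "\<And>k. k \<ge> N \<Longrightarrow> norm (a * q k + real k * (q k - q (k - 1)) - l) < a * \<epsilon>"
      using LIMSEQ_D[OF l, of "a * \<epsilon>"] a \<epsilon> by auto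
    have step: "(a + real (Suc k)) * s (Suc k) \<le> real (Suc k) * s k + a * \<epsilon>" if "k \<ge> N" for k
    proof -
      have "(a + real (Suc k)) * (q (Suc k) - l / a) = real (Suc k) * (q k - l / a)
          + (a * q (Suc k) + real (Suc k) * (q (Suc k) - q (Suc k - 1)) - l)"
        using a by (simp add: field_simps)
      then have "\<bar>(a + real (Suc k)) * (q (Suc k) - l / a)\<bar> \<le> \<bar>real (Suc k) * (q k - l / a)\<bar> + a * \<epsilon>"
        using N[of "Suc k"] that unfolding real_norm_def by linarith
      then show ?thesis using a by (simp add: s_def abs_mult)
    qed
    \<comment> \<open>The perturbation \<open>a * \<epsilon>\<close> is exactly what keeps the level
      \<epsilon> fixed, so the excess above \<epsilon> obeys the unperturbed contraction. An excess
      below \<epsilon> then puts \<open>s k\<close> below 2 \<epsilon> = r.\<close>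
    define v where "v k = max 0 (s k - \<epsilon>)" for k
    have v0: "v k \<ge> 0" for k by (simp add: v_def)
    have vstep: "(a + real (Suc k)) * v (Suc k) \<le> real (Suc k) * v k" if "k \<ge> N" for k
    proof (cases "s (Suc k) \<le> \<epsilon>")
      case False
      have "(a + real (Suc k)) * (s (Suc k) - \<epsilon>) \<le> real (Suc k) * (s k - \<epsilon>)"
        using step[OF that] by (simp add: algebra_simps)
      also have "\<dots> \<le> real (Suc k) * v k"
        by (intro mult_left_mono) (auto simp: v_def)
      finally show ?thesis using False by (simp add: v_def)
    qed (simp add: v_def)
    have vdec: "v (Suc k) \<le> v k - a * v (Suc k) / real (Suc k)" if "k \<ge> N" for k
      using vstep[OF that] by (simp add: field_simps)
    have vconv: "convergent v \<and> summable (\<lambda>k. a * v (Suc k) / real (Suc k))"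
      by (rule convergent_summable_of_decrease[where K = N]) (use vdec a v0 in auto)
    then obtain x where x: "v \<longlonglongrightarrow> x" by (auto simp: convergent_def)
    have x0: "x \<ge> 0" using x v0 by (intro LIMSEQ_le_const) auto
    \<comment> \<open>A positive limit would bound the summable losses
      \<open>a * v (Suc k) / real (Suc k)\<close> below by a multiple of the harmonic
      series.\<close>
    have "x = 0"
    proof (rule ccontr)
      assume "x \<noteq> 0"
      with x0 have xp: "x > 0" by simp
      then have "eventually (\<lambda>k. v (Suc k) > x / 2) sequentially"
        using order_tendstoD(1)[OF LIMSEQ_Suc[OF x], of "x / 2"] by simp
      then obtain M where M: "\<And>k. k \<ge> M \<Longrightarrow> v (Suc k) > x / 2"
        by (auto simp: eventually_sequentially)
      have "summable (\<lambda>k. (a * x / 2) * (1 / real (Suc k)))"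
      proof (rule summable_comparison_test'[where N = M])
        show "summable (\<lambda>k. a * v (Suc k) / real (Suc k))" using vconv by simp
        fix k assume "k \<ge> M"
        then have "a * (x / 2) \<le> a * v (Suc k)"
          using M[of k] a by (intro mult_left_mono) auto
        then have "a * (x / 2) / real (Suc k) \<le> a * v (Suc k) / real (Suc k)"
          by (rule divide_right_mono) simp
        then show "norm (a * x / 2 * (1 / real (Suc k))) \<le> a * v (Suc k) / real (Suc k)"
          using a xp by simp
      qed
      then have "summable (\<lambda>k. 1 / real (Suc k))"
        using a xp by (subst (asm) summable_cmult_iff) auto
      then show False
        using not_summable_harmonic[where 'a = real] summable_Suc_iff[of "\<lambda>n. 1 / real n"]
        by (simp add: inverse_eq_divide)
    qed
    then have "eventually (\<lambda>k. v k < \<epsilon>) sequentially"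
      using order_tendstoD(2)[OF x] \<epsilon> by simp
    then have "eventually (\<lambda>k. norm (q k - l / a) < r) sequentially"
      by eventually_elim (simp add: v_def s_def \<epsilon>_def max_def split: if_splits)
    then show "\<exists>no. \<forall>n\<ge>no. norm (q n - l / a) < r"
      by (simp add: eventually_sequentially)
  qed
  then show ?thesis by (auto simp: convergent_def)
qed

lemma tendsto_zero_of_weighted:
  fixes f :: "nat \<Rightarrow> real"
  assumes "summable (\<lambda>k. real k * f (Suc k))" "\<And>k. f k \<ge> 0"
  shows "(\<lambda>k. real k * f k) \<longlonglongrightarrow> 0"
proof -
  have "(\<lambda>k. 2 * (real k * f (Suc k))) \<longlonglongrightarrow> 0"
    using tendsto_mult_right_zero[OF summable_LIMSEQ_zero[OF assms(1)]] .
  then have "(\<lambda>k. real (Suc k) * f (Suc k)) \<longlonglongrightarrow> 0"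
  proof (rule Lim_null_comparison[rotated])
    show "\<forall>\<^sub>F k in sequentially. norm (real (Suc k) * f (Suc k)) \<le> 2 * (real k * f (Suc k))"
      using eventually_ge_at_top[of 1]
    proof eventually_elim
      case (elim k)
      then have "real (Suc k) * f (Suc k) \<le> (2 * real k) * f (Suc k)"
        using assms(2) by (intro mult_right_mono) auto
      then show ?case using assms(2)[of "Suc k"] by (simp add: abs_mult)
    qed
  qed
  then show ?thesis by (rule LIMSEQ_imp_Suc)
qed

section \<open>The abstract inertial scheme\<close>

locale inertial_scheme =
  fixes z V e :: "nat \<Rightarrow> 'a::real_inner" and \<alpha> \<eta> :: real
  assumes \<alpha>: "\<alpha> > 2" and \<eta>: "0 \<le> \<eta>" "\<eta> < 1 / 2"
    and recursion: "k \<ge> 1 \<Longrightarrow> real k *\<^sub>R (z k - z (k - 1)) =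
      (real k + \<alpha>) *\<^sub>R (z (Suc k) - z k) + \<alpha> *\<^sub>R V (Suc k) + (2 * real k) *\<^sub>R (V (Suc k) - V k)"
    and error: "k \<ge> 2 \<Longrightarrow> norm (e k) \<le> \<eta> * norm (V k - V (k - 1))"
    and monotone_step:
      "k \<ge> 1 \<Longrightarrow> (z (Suc k) - z k) \<bullet> ((V (Suc k) - e (Suc k)) - (V k - e k)) \<ge> 0"
begin

definition anchored :: "'a \<Rightarrow> nat \<Rightarrow> real" where
  "anchored p k = anchored_energy \<alpha> k (z k - p) (real k *\<^sub>R (z k - z (k - 1))) (V k)"

definition velocity :: "nat \<Rightarrow> real" where
  "velocity k = velocity_energy \<alpha> k (real k *\<^sub>R (z k - z (k - 1))) (V k) (e k) (V k - V (k - 1))"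

text \<open>Pairs z_k - p with the value of the monotone operator at z_k. Its nonnegativity is the
  only property of p that the convergence analysis uses.\<close>

definition gap :: "'a \<Rightarrow> nat \<Rightarrow> real" where
  "gap p k = (z k - p) \<bullet> (V k - e k)"

definition dissipation :: "real \<Rightarrow> real \<Rightarrow> 'a \<Rightarrow> nat \<Rightarrow> real" where
  "dissipation \<theta> m p k =
     4 * \<theta> * (\<alpha> - 2) * gap p (Suc k)
     + 2 / 3 * m * k * ((norm (z (Suc k) - z k))\<^sup>2 + (norm (V (Suc k)))\<^sup>2)
     + (2 - 4 * \<eta>) / 2 * (real k)\<^sup>2 * (norm (V (Suc k) - V k))\<^sup>2"

lemma norm_e_le: "k \<ge> 2 \<Longrightarrow> norm (e k) \<le> norm (V k - V (k - 1)) / 2"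
  using error[of k] mult_right_mono[of \<eta> "1 / 2" "norm (V k - V (k - 1))"] \<eta> by simp

lemma norm_e_Suc_le:
  assumes "k \<ge> 1"
  shows "norm (e (Suc k)) \<le> norm (V (Suc k) - V k)"
proof -
  have "norm (e (Suc k)) \<le> norm (V (Suc k) - V k) / 2"
    using norm_e_le[of "Suc k"] assms by simp
  also have "\<dots> \<le> norm (V (Suc k) - V k)" by simp
  finally show ?thesis .
qed

lemma energy_bound_norm:
  assumes "k \<ge> 2" "\<theta> > 0" "gap p k \<ge> 0"
  shows "2 * \<theta> * (\<alpha> - 1 - \<theta>) * (norm (z k - p))\<^sup>2 \<le> 2 * \<theta> * anchored p k + velocity k"
  using energy_lower_bound[of "real k" \<alpha> \<theta> "e k" "V k - V (k - 1)" "z k - p" "V k"]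
    norm_e_le[of k] assms \<alpha>
  unfolding anchored_def velocity_def energy_def gap_def by simp

text \<open>The |x|^2 remainder of \<open>energy_step\<close> is bounded through
  \<open>energy_bound_norm\<close> by c / k^2 times the next energy, so the almost-decrease lemma
  applies; \<open>c\<close> is the quotient of the two coefficients.\<close>

lemma energy_convergent:
  fixes p :: 'a and \<theta> :: real
  assumes gap: "\<And>k. k \<ge> 1 \<Longrightarrow> gap p k \<ge> 0" and \<theta>: "1 < \<theta>" "\<theta> < \<alpha> - 1"
  defines "m \<equiv> min (\<alpha> - 1 - \<theta>) (\<theta> - 1)"
  shows "convergent (\<lambda>k. 2 * \<theta> * anchored p k + velocity k) \<and> summable (dissipation \<theta> m p)"
proof -
  define \<mu> where "\<mu> = \<alpha> - 1 - \<theta>"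
  define \<delta> where "\<delta> = 2 - 4 * \<eta>"
  define c where "c = 4 * \<theta>\<^sup>2 * (\<alpha> - 2)\<^sup>2 / \<delta> / (2 * \<theta> * \<mu>)"
  have \<mu>: "\<mu> > 0" and \<delta>: "\<delta> > 0" and m: "m > 0"
    using \<theta> \<eta> by (auto simp: \<mu>_def \<delta>_def m_def)
  have c: "c > 0" using \<alpha> \<theta> \<mu> \<delta> by (simp add: c_def)
  define \<beta> where "\<beta> = 3 * \<alpha>\<^sup>2 / m"
  have \<beta>: "\<beta> > 0" using \<alpha> m by (simp add: \<beta>_def)
  \<comment> \<open>From \<open>N\<close> on, the lower-order terms are dominated as
    \<open>energy_step\<close> demands; the quadratic condition reduces to a linear one by
    estimating 2 by 2 k.\<close>
  obtain N :: nat
    where N': "real N \<ge> max (2 * (\<alpha> - 1 + \<mu> * \<alpha>) / (m / 3)) (max 1 ((2 + \<beta>) / (\<delta> / 4)))"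
    using real_arch_simple by blast
  have N: "2 * (\<alpha> - 1 + \<mu> * \<alpha>) \<le> m / 3 * real k"
    "2 + 3 * \<alpha>\<^sup>2 / m * real k \<le> \<delta> / 4 * (real k)\<^sup>2" if "k \<ge> N" for k
  proof -
    have k: "2 * (\<alpha> - 1 + \<mu> * \<alpha>) / (m / 3) \<le> real k" "1 \<le> real k" "(2 + \<beta>) / (\<delta> / 4) \<le> real k"
      using N' that by linarith+
    show "2 * (\<alpha> - 1 + \<mu> * \<alpha>) \<le> m / 3 * real k"
      using k(1) m by (simp add: field_simps)
    have "2 + \<beta> * real k \<le> (2 + \<beta>) * real k"
      using k(2) by (simp add: algebra_simps)
    also have "\<dots> \<le> (\<delta> / 4 * real k) * real k"
      using k(3) \<delta> by (intro mult_right_mono) (auto simp: field_simps)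
    finally show "2 + 3 * \<alpha>\<^sup>2 / m * real k \<le> \<delta> / 4 * (real k)\<^sup>2"
      by (simp add: \<beta>_def power2_eq_square)
  qed
  show ?thesis
  proof (rule convergent_summable_of_almost_decrease[where K = "max N 2" and c = c])
    fix k assume "k \<ge> max N 2"
    then have k: "k \<ge> N" "k \<ge> 2" by auto
    let ?x = "z (Suc k) - p" and ?d = "z (Suc k) - z k"
    have sub: "?x - ?d = z k - p" by simp
    have "energy \<alpha> \<theta> (real k + 1) ?x ((real k + 1) *\<^sub>R ?d) (V (Suc k)) (e (Suc k)) (V (Suc k) - V k)
      \<le> energy \<alpha> \<theta> (real k) (?x - ?d) (real k *\<^sub>R (z k - z (k - 1))) (V k) (e k) (V k - V (k - 1))
      - dissipation \<theta> m p k
      + 4 * \<theta>\<^sup>2 * (\<alpha> - 2)\<^sup>2 / \<delta> / (real k)\<^sup>2 * (norm ?x)\<^sup>2"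
      unfolding dissipation_def gap_def \<delta>_def[symmetric]
    proof (rule energy_step[where \<eta> = \<eta>])
      show "real k *\<^sub>R (z k - z (k - 1)) = (real k + \<alpha>) *\<^sub>R (z (Suc k) - z k)
          + \<alpha> *\<^sub>R V (Suc k) + (2 * real k) *\<^sub>R (V (Suc k) - V k)"
        using recursion k by simp
      show "norm (e (Suc k)) \<le> \<eta> * norm (V (Suc k) - V k)"
        using error[of "Suc k"] k by simp
    qed (use \<alpha> m \<eta> \<delta> error[OF k(2)] monotone_step k N[OF k(1)] in
        \<open>auto simp: \<delta>_def \<mu>_def m_def\<close>)
    then have "2 * \<theta> * anchored p (Suc k) + velocity (Suc k)
        \<le> 2 * \<theta> * anchored p k + velocity k - dissipation \<theta> m p k
          + 4 * \<theta>\<^sup>2 * (\<alpha> - 2)\<^sup>2 / \<delta> / (real k)\<^sup>2 * (norm ?x)\<^sup>2"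
      unfolding energy_def anchored_def velocity_def sub by (simp add: add.commute)
    also have "4 * \<theta>\<^sup>2 * (\<alpha> - 2)\<^sup>2 / \<delta> / (real k)\<^sup>2 * (norm ?x)\<^sup>2
        = c / (real k)\<^sup>2 * (2 * \<theta> * \<mu> * (norm ?x)\<^sup>2)"
      using \<theta> \<mu> by (simp add: c_def)
    also have "\<dots> \<le> c / (real k)\<^sup>2 * (2 * \<theta> * anchored p (Suc k) + velocity (Suc k))"
      unfolding \<mu>_def using c \<theta> gap k by (intro mult_left_mono energy_bound_norm) auto
    finally show "2 * \<theta> * anchored p (Suc k) + velocity (Suc k)
        \<le> 2 * \<theta> * anchored p k + velocity k - dissipation \<theta> m p k
          + c / (real k)\<^sup>2 * (2 * \<theta> * anchored p (Suc k) + velocity (Suc k))"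
      by simp
    show "dissipation \<theta> m p k \<ge> 0"
      unfolding dissipation_def \<delta>_def[symmetric] using \<theta> \<alpha> m \<delta> gap[of "Suc k"] by simp
    have "0 \<le> 2 * \<theta> * (\<alpha> - 1 - \<theta>) * (norm (z k - p))\<^sup>2"
      using \<theta> by simp
    also have "\<dots> \<le> 2 * \<theta> * anchored p k + velocity k"
      using \<theta> gap k by (intro energy_bound_norm) auto
    finally show "0 \<le> 2 * \<theta> * anchored p k + velocity k" .
  qed (rule c)
qed

section \<open>Summability and limits relative to a fixed point p\<close>

context
  fixes p :: 'a
  assumes gap: "\<And>k. k \<ge> 1 \<Longrightarrow> gap p k \<ge> 0"
begin

lemma summable_parts:
  shows "summable (\<lambda>k. gap p (Suc k))"
    and "summable (\<lambda>k. real k * (norm (z (Suc k) - z k))\<^sup>2)"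
    and "summable (\<lambda>k. real k * (norm (V (Suc k)))\<^sup>2)"
    and "summable (\<lambda>k. (real k)\<^sup>2 * (norm (V (Suc k) - V k))\<^sup>2)"
proof -
  \<comment> \<open>\<alpha> / 2 is the midpoint of the admissible interval from 1 to \<alpha> -
    1.\<close>
  define \<theta> m where "\<theta> = \<alpha> / 2" and "m = min (\<alpha> - 1 - \<theta>) (\<theta> - 1)"
  have \<theta>: "1 < \<theta>" "\<theta> < \<alpha> - 1" using \<alpha> by (auto simp: \<theta>_def)
  then have m: "m > 0" by (simp add: m_def)
  have sum: "summable (dissipation \<theta> m p)"
    using energy_convergent[OF gap \<theta>] by (simp add: m_def)
  have part: "summable f" if "c > 0" "\<And>k. f k \<ge> 0" "\<And>k. c * f k \<le> dissipation \<theta> m p k"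
    for f :: "nat \<Rightarrow> real" and c
  proof -
    have "summable (\<lambda>k. c * f k)"
      by (rule summable_comparison_test'[OF sum, where N = 0]) (use that in auto)
    with that(1) show ?thesis by (simp add: summable_cmult_iff)
  qed
  define A B C where "A k = 4 * \<theta> * (\<alpha> - 2) * gap p (Suc k)"
    and "B k = 2 / 3 * m * k * ((norm (z (Suc k) - z k))\<^sup>2 + (norm (V (Suc k)))\<^sup>2)"
    and "C k = (2 - 4 * \<eta>) / 2 * (real k)\<^sup>2 * (norm (V (Suc k) - V k))\<^sup>2" for k :: nat
  have diss: "dissipation \<theta> m p k = A k + B k + C k" for k
    by (simp add: dissipation_def A_def B_def C_def)
  have nn: "A k \<ge> 0" "B k \<ge> 0" "C k \<ge> 0" for k
    using gap[of "Suc k"] \<alpha> \<theta> m \<eta> by (simp_all add: A_def B_def C_def)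
  show "summable (\<lambda>k. gap p (Suc k))"
    by (rule part[of "4 * \<theta> * (\<alpha> - 2)"])
      (use \<theta> \<alpha> gap nn in \<open>auto simp: diss simp flip: A_def\<close>)
  have B: "summable (\<lambda>k. real k * ((norm (z (Suc k) - z k))\<^sup>2 + (norm (V (Suc k)))\<^sup>2))"
  proof (rule part[of "2 / 3 * m"])
    show "2 / 3 * m * (real k * ((norm (z (Suc k) - z k))\<^sup>2 + (norm (V (Suc k)))\<^sup>2))
        \<le> dissipation \<theta> m p k" for k
      using nn[of k] unfolding diss B_def mult.assoc by linarith
  qed (use m in auto)
  show "summable (\<lambda>k. real k * (norm (z (Suc k) - z k))\<^sup>2)"
    by (rule summable_comparison_test'[OF B, where N = 0]) (simp add: distrib_left)
  show "summable (\<lambda>k. real k * (norm (V (Suc k)))\<^sup>2)"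
    by (rule summable_comparison_test'[OF B, where N = 0]) (simp add: distrib_left)
  show "summable (\<lambda>k. (real k)\<^sup>2 * (norm (V (Suc k) - V k))\<^sup>2)"
  proof (rule part[of "(2 - 4 * \<eta>) / 2"])
    show "(2 - 4 * \<eta>) / 2 * ((real k)\<^sup>2 * (norm (V (Suc k) - V k))\<^sup>2) \<le> dissipation \<theta> m p k" for k
      using nn[of k] unfolding diss C_def mult.assoc by linarith
  qed (use \<eta> in auto)
qed

lemma bounded_distance: "\<exists>B. \<forall>k. norm (z k - p) \<le> B"
proof -
  define \<theta> where "\<theta> = \<alpha> / 2"
  have \<theta>: "1 < \<theta>" "\<theta> < \<alpha> - 1" using \<alpha> by (auto simp: \<theta>_def)
  have "Bseq (\<lambda>k. 2 * \<theta> * anchored p k + velocity k)"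
    using energy_convergent[OF gap \<theta>] by (intro convergent_imp_Bseq) simp
  then obtain M where M: "\<And>k. norm (2 * \<theta> * anchored p k + velocity k) \<le> M"
    unfolding Bseq_def by blast
  define c where "c = 2 * \<theta> * (\<alpha> - 1 - \<theta>)"
  have c: "c > 0" using \<theta> by (simp add: c_def)
  have "(norm (z k - p))\<^sup>2 \<le> M / c" if "k \<ge> 2" for k
  proof -
    have "c * (norm (z k - p))\<^sup>2 \<le> M"
      using energy_bound_norm[of k \<theta> p] M[of k] gap that \<theta> unfolding c_def by simp
    then show ?thesis using c by (simp add: field_simps)
  qed
  then have le: "norm (z k - p) \<le> sqrt (M / c)" if "k \<ge> 2" for k
    using that real_le_rsqrt by blast
  define B where "B = max (sqrt (M / c)) (max (norm (z 0 - p)) (norm (z 1 - p)))"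
  have "norm (z k - p) \<le> B" for k
  proof (cases "k \<ge> 2")
    case False
    then have "k = 0 \<or> k = 1" by auto
    then show ?thesis by (auto simp: B_def)
  qed (use le in \<open>auto simp: B_def intro: le_max_iff_disj[THEN iffD2]\<close>)
  then show ?thesis by blast
qed

lemma summable_norm_diff_V: "summable (\<lambda>k. norm (V (Suc k) - V k))"
proof (rule summable_comparison_test'[where N = 1])
  show "summable (\<lambda>k. (real k)\<^sup>2 * (norm (V (Suc k) - V k))\<^sup>2 + 1 / (real k)\<^sup>2)"
    using inverse_power_summable[of 2, where 'a = real]
    by (intro summable_add summable_parts(4)) (simp add: field_simps)
  fix k :: nat assume "k \<ge> 1"
  then have "2 * norm (V (Suc k) - V k) * 1 \<le> (real k)\<^sup>2 * (norm (V (Suc k) - V k))\<^sup>2 + 1\<^sup>2 / (real k)\<^sup>2"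
    by (intro weighted_am_gm) simp
  then show "norm (norm (V (Suc k) - V k))
      \<le> (real k)\<^sup>2 * (norm (V (Suc k) - V k))\<^sup>2 + 1 / (real k)\<^sup>2"
    unfolding real_norm_def abs_norm_cancel mult_1_right one_power2
    using norm_ge_zero[of "V (Suc k) - V k"] by linarith
qed

text \<open>Each term is the gap plus (z_k - p) \<bullet> e_k. The gap is summable, and since z_k -
  p is bounded the rest is dominated by the summable increments of V.\<close>

lemma summable_inner_V: "summable (\<lambda>k. (z k - p) \<bullet> V k)"
proof -
  obtain B where B: "\<And>k. norm (z k - p) \<le> B" using bounded_distance by blast
  have "summable (\<lambda>k. (z (Suc k) - p) \<bullet> e (Suc k))"
  proof (rule summable_comparison_test'[where N = 1])
    show "summable (\<lambda>k. B * norm (V (Suc k) - V k))"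
      by (intro summable_mult summable_norm_diff_V)
    fix k :: nat assume k: "k \<ge> 1"
    have "norm ((z (Suc k) - p) \<bullet> e (Suc k)) \<le> norm (z (Suc k) - p) * norm (e (Suc k))"
      by (simp add: Cauchy_Schwarz_ineq2)
    also have "\<dots> \<le> B * norm (V (Suc k) - V k)"
      using B[of "Suc k"] norm_e_Suc_le[OF k]
      by (intro mult_mono) (auto intro: order_trans[OF norm_ge_zero])
    finally show "norm ((z (Suc k) - p) \<bullet> e (Suc k)) \<le> B * norm (V (Suc k) - V k)" .
  qed
  with summable_parts(1) have "summable (\<lambda>k. gap p (Suc k) + (z (Suc k) - p) \<bullet> e (Suc k))"
    by (rule summable_add)
  then have "summable (\<lambda>k. (z (Suc k) - p) \<bullet> V (Suc k))"
    by (simp add: gap_def inner_simps)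
  then show ?thesis
    using summable_Suc_iff[of "\<lambda>k. (z k - p) \<bullet> V k"] by blast
qed

lemma anchored_convergent: "convergent (anchored p)"
proof -
  \<comment> \<open>The two points that trisect the interval from 1 to \<alpha> - 1.\<close>
  define \<theta>1 \<theta>2 where "\<theta>1 = (\<alpha> + 1) / 3" and "\<theta>2 = (2 * \<alpha> - 1) / 3"
  have "1 < \<theta>1" "\<theta>1 < \<alpha> - 1" "1 < \<theta>2" "\<theta>2 < \<alpha> - 1" and ne: "\<theta>1 - \<theta>2 \<noteq> 0"
    using \<alpha> by (auto simp: \<theta>1_def \<theta>2_def)
  then have "convergent (\<lambda>k. 2 * \<theta>1 * anchored p k + velocity k)"
    "convergent (\<lambda>k. 2 * \<theta>2 * anchored p k + velocity k)"
    using energy_convergent[OF gap] by auto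
  then have "convergent (\<lambda>k. (2 * \<theta>1 * anchored p k + velocity k)
      - (2 * \<theta>2 * anchored p k + velocity k))"
    by (rule convergent_diff)
  then have "convergent (\<lambda>k. 2 * (\<theta>1 - \<theta>2) * anchored p k)"
    by (simp add: algebra_simps)
  with ne show ?thesis by (subst (asm) convergent_mult_const_iff) auto
qed

lemma distance_convergent: "convergent (\<lambda>k. (norm (z k - p))\<^sup>2)"
proof -
  define q t S where "q k = (norm (z k - p))\<^sup>2" and "t k = (z k - p) \<bullet> V k"
    and "S k = (\<Sum>j\<le>k. t j)" for k
  \<comment> \<open>Adding the partial sums of \<open>t\<close> turns the energy into a first-order relaxation of \<open>r\<close>.\<close>
  define r where "r k = q k + 4 * S k" for k
  have S: "convergent S"
    using summable_inner_V unfolding S_def t_def summable_iff_convergent' .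
  have d: "convergent (\<lambda>k. real k * (norm (z k - z (k - 1)))\<^sup>2)"
    using tendsto_zero_of_weighted[of "\<lambda>k. (norm (z k - z (k - 1)))\<^sup>2"] summable_parts(2)
    by (auto simp: convergent_def)
  \<comment> \<open>Uses 2 k (z_k - p) \<bullet> d_k = k (q_k - q_(k-1)) + k |d_k|^2, while 4 k t_k
    is k times the increment of 4 S.\<close>
  have "(\<alpha> - 1) * r k + real k * (r k - r (k - 1))
      = anchored p k - real k * (norm (z k - z (k - 1)))\<^sup>2 + 4 * (\<alpha> - 1) * S k" for k
  proof (cases k)
    case (Suc n)
    define a where "a = (z k - p) \<bullet> (z k - z n)"
    have "z n - p = (z k - p) - (z k - z n)" by simp
    then have q: "q n = q k - 2 * a + (norm (z k - z n))\<^sup>2"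
      unfolding q_def a_def power2_norm_eq_inner by (simp add: inner_simps inner_commute)
    have S: "S n = S k - t k" by (simp add: S_def Suc)
    have anchored: "anchored p k = (\<alpha> - 1) * q k + 2 * real k * a + 4 * real k * t k"
      unfolding anchored_def anchored_energy_def q_def a_def t_def power2_norm_eq_inner
      by (simp add: Suc)
    have n: "k - 1 = n" by (simp add: Suc)
    show ?thesis
      unfolding n anchored r_def q S by (simp add: algebra_simps)
  qed (simp add: r_def anchored_def anchored_energy_def q_def power2_norm_eq_inner algebra_simps)
  moreover have "convergent (\<lambda>k. anchored p k - real k * (norm (z k - z (k - 1)))\<^sup>2 + 4 * (\<alpha> - 1) * S k)"
    by (rule convergent_add[OF convergent_diff[OF anchored_convergent d]
          convergent_mult[OF convergent_const S]])
  ultimately have "convergent r"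
    using convergent_of_relaxation[of "\<alpha> - 1" r] \<alpha> by simp
  then have "convergent (\<lambda>k. r k - 4 * S k)"
    by (rule convergent_diff[OF _ convergent_mult[OF convergent_const S]])
  then show ?thesis by (simp add: r_def q_def)
qed

lemma V_e_tendsto_zero: "V \<longlonglongrightarrow> 0" "e \<longlonglongrightarrow> 0"
proof -
  have "(\<lambda>k. norm (V k)) \<longlonglongrightarrow> 0"
  proof -
    have "(\<lambda>k. real k * (norm (V k))\<^sup>2) \<longlonglongrightarrow> 0"
      by (rule tendsto_zero_of_weighted[OF summable_parts(3)]) simp
    then have "(\<lambda>k. (norm (V k))\<^sup>2) \<longlonglongrightarrow> 0"
    proof (rule Lim_null_comparison[rotated])
      show "\<forall>\<^sub>F k in sequentially. norm ((norm (V k))\<^sup>2) \<le> real k * (norm (V k))\<^sup>2"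
        using eventually_ge_at_top[of 1] by eventually_elim (use mult_right_mono[of 1 "real _" "(norm (V _))\<^sup>2"] in auto)
    qed
    from tendsto_real_sqrt[OF this] show ?thesis by simp
  qed
  then show V: "V \<longlonglongrightarrow> 0" by (rule tendsto_norm_zero_cancel)
  have "(\<lambda>k. e (Suc k)) \<longlonglongrightarrow> 0"
  proof (rule Lim_null_comparison)
    show "(\<lambda>k. norm (V (Suc k) - V k)) \<longlonglongrightarrow> 0"
      by (rule summable_LIMSEQ_zero[OF summable_norm_diff_V])
    show "\<forall>\<^sub>F k in sequentially. norm (e (Suc k)) \<le> norm (V (Suc k) - V k)"
      using eventually_ge_at_top[of 1]
      by eventually_elim (rule norm_e_Suc_le)
  qed
  then show "e \<longlonglongrightarrow> 0" by (rule LIMSEQ_imp_Suc)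
qed

end

end

section \<open>Normal cones\<close>

lemma normal_cone_closest_point:
  fixes C :: "'a::euclidean_space set"
  assumes "closed C" "convex C" "C \<noteq> {}"
  shows "x - closest_point C x \<in> normal_cone C (closest_point C x)"
  using assms closest_point_in_set[of C x] closest_point_dot[of C _ x]
  by (auto simp: normal_cone_def inner_commute)

lemma normal_cone_scaleR:
  assumes "w \<in> normal_cone C z" "c \<ge> 0"
  shows "c *\<^sub>R w \<in> normal_cone C z"
  using assms by (auto simp: normal_cone_def mult_nonneg_nonpos split: if_splits)

lemma normal_cone_monotone:
  assumes "u \<in> normal_cone C x" "v \<in> normal_cone C y"
  shows "(x - y) \<bullet> (u - v) \<ge> 0"
proof -
  have "(y - x) \<bullet> u \<le> 0" "(x - y) \<bullet> v \<le> 0"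
    using assms by (auto simp: normal_cone_def split: if_splits)
  then show ?thesis by (simp add: inner_simps)
qed

section \<open>The algorithm as an inertial scheme\<close>

theorem theorem3p2:
  fixes F :: "real ^ 'd \<Rightarrow> real ^ 'd"
    and C :: "(real ^ 'd) set"
    and L \<alpha> \<gamma> :: real
    and z w \<zeta> :: "nat \<Rightarrow> real ^ 'd"
  assumes "monotone_operator F"
    and "L > 0" and "L-lipschitz_on UNIV F"
    and "C \<noteq> {}" and "closed C" and "convex C"
    and "VI_solutions F C \<noteq> {}"
    and "\<alpha> > 2" and "0 < \<gamma>" and "\<gamma> < 1 / (4 * L)"
    and "fOGDA_VI F C \<alpha> \<gamma> z w \<zeta>"
  shows "\<exists>zs \<in> VI_solutions F C. z \<longlonglongrightarrow> zs"
proof -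
  note mono = assms(1) and L = assms(2) and lip = assms(3) and C = assms(5,6,4)
    and \<alpha> = assms(8) and \<gamma> = assms(9)
  have w: "w k = z k + (real k / (real k + \<alpha>)) *\<^sub>R (z k - z (k - 1))
              - (\<gamma> * (\<alpha> / (real k + \<alpha>))) *\<^sub>R (F (w (k - 1)) + \<zeta> k)"
    and z: "z (k + 1) = closest_point C
              (w k - (\<gamma> * (1 + real k / (real k + \<alpha>))) *\<^sub>R (F (w k) - F (w (k - 1)) - \<zeta> k))"
    and \<zeta>: "\<zeta> (k + 1) = ((real k + \<alpha>) / (\<gamma> * (2 * real k + \<alpha>))) *\<^sub>R (w k - z (k + 1))
              - (F (w k) - F (w (k - 1)) - \<zeta> k)"
    if "k \<ge> 1" for k
    using assms(11) that unfolding fOGDA_VI_def by blast+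
  \<comment> \<open>\<open>V 0\<close> contains the unconstrained \<open>\<zeta> 0\<close>, so
    \<open>V 1 - V 0\<close> is not controlled and the error estimate starts at k = 2.\<close>
  define V e where "V k = \<gamma> *\<^sub>R (F (w (k - 1)) + \<zeta> k)"
    and "e k = \<gamma> *\<^sub>R (F (w (k - 1)) - F (z k))" for k
  have V_minus_e: "V k - e k = \<gamma> *\<^sub>R (F (z k) + \<zeta> k)" for k
    by (simp add: V_def e_def algebra_simps)
  \<comment> \<open>The update of \<zeta> makes w_k - z_(k+1) a multiple of the increment of V. This
    both eliminates w_k from the recursion and bounds the error e_(k+1).\<close>
  have correction: "(real k + \<alpha>) *\<^sub>R (w k - z (Suc k)) = (2 * real k + \<alpha>) *\<^sub>R (V (Suc k) - V k)"
    if "k \<ge> 1" for k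
  proof -
    have "V (Suc k) - V k = \<gamma> *\<^sub>R (F (w k) + \<zeta> (k + 1) - (F (w (k - 1)) + \<zeta> k))"
      by (simp add: V_def scaleR_diff_right)
    also have "\<dots> = \<gamma> *\<^sub>R (((real k + \<alpha>) / (\<gamma> * (2 * real k + \<alpha>))) *\<^sub>R (w k - z (Suc k)))"
      unfolding \<zeta>[OF that] by simp
    also have "\<dots> = ((real k + \<alpha>) / (2 * real k + \<alpha>)) *\<^sub>R (w k - z (Suc k))"
      using \<gamma> by simp
    finally show ?thesis using \<alpha> by simp
  qed
  have normal: "\<zeta> k \<in> normal_cone C (z k)" if "k \<ge> 1" for k
  proof (cases "k = 1")
    case True
    then show ?thesis using assms(11) by (simp add: fOGDA_VI_def)
  next
    case False
    define n where "n = k - 1"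
    have n: "k = n + 1" "n \<ge> 1" using that False by (auto simp: n_def)
    \<comment> \<open>\<open>c\<close> is the reciprocal of the step size in the projection, so
      \<zeta>_k is a nonnegative multiple of the projection residual \<open>x - z k\<close>, a
      normal vector.\<close>
    define c where "c = (real n + \<alpha>) / (\<gamma> * (2 * real n + \<alpha>))"
    define x where "x = w n - (\<gamma> * (1 + real n / (real n + \<alpha>))) *\<^sub>R (F (w n) - F (w (n - 1)) - \<zeta> n)"
    have "1 + real n / (real n + \<alpha>) = (2 * real n + \<alpha>) / (real n + \<alpha>)"
      using \<alpha> by (simp add: field_simps)
    moreover have "real n + \<alpha> > 0" "2 * real n + \<alpha> > 0" using \<alpha> by auto
    ultimately have c: "c \<ge> 0" "c * (\<gamma> * (1 + real n / (real n + \<alpha>))) = 1"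
      using \<gamma> by (simp_all add: c_def)
    have "c *\<^sub>R (x - z k) = \<zeta> k"
      using c(2) unfolding n \<zeta>[OF n(2)] c_def[symmetric] x_def
      by (simp add: scaleR_diff_right)
    moreover have "x - z k \<in> normal_cone C (z k)"
      using normal_cone_closest_point[OF C, of x] z[OF n(2)] by (simp add: x_def n)
    ultimately show ?thesis
      using normal_cone_scaleR[OF _ c(1)] by metis
  qed
  \<comment> \<open>The factor 2 bounds (2 n + \<alpha>) / (n + \<alpha>) in
    \<open>correction\<close>, and L \<gamma> comes from the Lipschitz estimate; \<gamma> < 1 / (4
    L) gives \<eta> < 1/2.\<close>
  define \<eta> where "\<eta> = 2 * L * \<gamma>"
  interpret inertial_scheme z V e \<alpha> \<eta>
  proof
    show "\<alpha> > 2" by (rule \<alpha>)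
    show "0 \<le> \<eta>" "\<eta> < 1 / 2"
      using L \<gamma> assms(10) by (auto simp: \<eta>_def field_simps)
    show "real k *\<^sub>R (z k - z (k - 1)) = (real k + \<alpha>) *\<^sub>R (z (Suc k) - z k) + \<alpha> *\<^sub>R V (Suc k)
        + (2 * real k) *\<^sub>R (V (Suc k) - V k)" if k: "k \<ge> 1" for k
    proof -
      have "(real k + \<alpha>) *\<^sub>R (w k - z k) = real k *\<^sub>R (z k - z (k - 1)) - \<alpha> *\<^sub>R V k"
      proof -
        have "w k - z k = (real k / (real k + \<alpha>)) *\<^sub>R (z k - z (k - 1))
            - (\<gamma> * (\<alpha> / (real k + \<alpha>))) *\<^sub>R (F (w (k - 1)) + \<zeta> k)"
          unfolding w[OF k] by simp
        moreover have "(real k + \<alpha>) *\<^sub>R ((real k / (real k + \<alpha>)) *\<^sub>R d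
            - (\<gamma> * (\<alpha> / (real k + \<alpha>))) *\<^sub>R u) = real k *\<^sub>R d - \<alpha> *\<^sub>R \<gamma> *\<^sub>R u"
          for d u :: "real ^ 'd"
          using \<alpha> by (simp add: scaleR_diff_right mult.commute)
        ultimately show ?thesis by (simp only: V_def)
      qed
      then have "real k *\<^sub>R (z k - z (k - 1))
          = (real k + \<alpha>) *\<^sub>R (w k - z (Suc k)) + (real k + \<alpha>) *\<^sub>R (z (Suc k) - z k) + \<alpha> *\<^sub>R V k"
        by (simp add: scaleR_diff_right)
      also have "\<dots> = (real k + \<alpha>) *\<^sub>R (z (Suc k) - z k) + \<alpha> *\<^sub>R V (Suc k)
          + (2 * real k) *\<^sub>R (V (Suc k) - V k)"
        unfolding correction[OF k] by (simp add: scaleR_diff_right scaleR_add_left)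
      finally show ?thesis .
    qed
    show "norm (e k) \<le> \<eta> * norm (V k - V (k - 1))" if k: "k \<ge> 2" for k
    proof -
      obtain n where n: "k = Suc n" "n \<ge> 1"
        using k by (cases k) auto
      have "(real n + \<alpha>) * norm (w n - z k) = (2 * real n + \<alpha>) * norm (V k - V n)"
        using arg_cong[OF correction[OF n(2)], of norm] \<alpha> by (simp add: n)
      also have "\<dots> \<le> (2 * (real n + \<alpha>)) * norm (V k - V n)"
        using \<alpha> by (intro mult_right_mono) auto
      finally have "(real n + \<alpha>) * norm (w n - z k) \<le> (real n + \<alpha>) * (2 * norm (V k - V n))"
        by (simp only: mult_ac)
      then have le: "norm (w n - z k) \<le> 2 * norm (V k - V n)"
        by (rule mult_left_le_imp_le) (use \<alpha> in simp)
      have "norm (F (w n) - F (z k)) \<le> L * norm (w n - z k)"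
        using lipschitz_onD[OF lip, of "w n" "z k"] by (simp add: dist_norm)
      also have "\<dots> \<le> L * (2 * norm (V k - V n))"
        using le L by (intro mult_left_mono) auto
      finally have "\<gamma> * norm (F (w n) - F (z k)) \<le> \<gamma> * (L * (2 * norm (V k - V n)))"
        using \<gamma> by (intro mult_left_mono) auto
      moreover have "norm (e k) = \<gamma> * norm (F (w n) - F (z k))"
        using \<gamma> by (simp add: e_def n)
      moreover have "\<gamma> * (L * (2 * norm (V k - V n))) = \<eta> * norm (V k - V (k - 1))"
        by (simp add: \<eta>_def n)
      ultimately show ?thesis by simp
    qed
    show "(z (Suc k) - z k) \<bullet> ((V (Suc k) - e (Suc k)) - (V k - e k)) \<ge> 0" if "k \<ge> 1" for k
    proof -
      have "(F (z (Suc k)) - F (z k)) \<bullet> (z (Suc k) - z k) \<ge> 0"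
        using mono by (simp add: monotone_operator_def)
      moreover have "(z (Suc k) - z k) \<bullet> (\<zeta> (Suc k) - \<zeta> k) \<ge> 0"
        using that by (intro normal_cone_monotone[of _ C] normal) auto
      ultimately have "(z (Suc k) - z k) \<bullet> ((F (z (Suc k)) + \<zeta> (Suc k)) - (F (z k) + \<zeta> k)) \<ge> 0"
        by (simp add: inner_simps inner_commute)
      then have "\<gamma> * ((z (Suc k) - z k) \<bullet> ((F (z (Suc k)) + \<zeta> (Suc k)) - (F (z k) + \<zeta> k))) \<ge> 0"
        using \<gamma> by simp
      then show ?thesis
        unfolding V_minus_e scaleR_diff_right[symmetric] inner_scaleR_right .
    qed
  qed
  \<comment> \<open>A solution p satisfies -F p in N_C(p), so 0 is a value of F + N_C at p and
    monotonicity of both summands applies.\<close>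
  have gap: "gap p k \<ge> 0" if p: "p \<in> VI_solutions F C" and "k \<ge> 1" for p k
  proof -
    have p': "- F p \<in> normal_cone C p"
      using p by (auto simp: VI_solutions_def normal_cone_def inner_commute)
    have "(F (z k) - F p) \<bullet> (z k - p) \<ge> 0"
      using mono by (simp add: monotone_operator_def)
    moreover have "(z k - p) \<bullet> (\<zeta> k - - F p) \<ge> 0"
      using normal_cone_monotone[OF normal[OF that(2)] p'] .
    ultimately have "(z k - p) \<bullet> (F (z k) + \<zeta> k) \<ge> 0"
      by (simp add: inner_simps inner_commute)
    then show ?thesis using \<gamma> by (simp add: gap_def V_minus_e)
  qed

  \<comment> \<open>Cluster points and Opial's argument\<close>
  obtain p where p: "p \<in> VI_solutions F C" using assms(7) by blast
  obtain B where B: "\<And>k. norm (z k - p) \<le> B"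
    using bounded_distance[of p] gap[OF p] by blast
  have "bounded (range z)"
    unfolding bounded_def using B by (metis dist_norm dist_commute imageE)
  then obtain x r where r: "strict_mono r" and x: "(z \<circ> r) \<longlonglongrightarrow> x"
    using bounded_imp_convergent_subsequence by blast
  have z_in_C: "z k \<in> C" if "k \<ge> 1" for k
    using normal[OF that] by (auto simp: normal_cone_def split: if_splits)
  \<comment> \<open>The shift skips index 0, where \<open>z 0\<close> is arbitrary and may lie
    outside C.\<close>
  have r1: "r (Suc k) \<ge> 1" for k
    using seq_suble[OF r, of "Suc k"] by simp
  have x': "(\<lambda>k. z (r (Suc k))) \<longlonglongrightarrow> x"
    using LIMSEQ_Suc[OF x] by (simp add: o_def)
  have x_in_C: "x \<in> C"
    using closed_sequentially[OF C(1) _ x'] z_in_C r1 by blast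
  have "continuous_on UNIV F"
    using lip by (rule lipschitz_on_continuous_on)
  then have F_lim: "(\<lambda>k. F (z (r (Suc k)))) \<longlonglongrightarrow> F x"
    by (rule continuous_on_tendsto_compose[OF _ x']) auto
  have "V \<longlonglongrightarrow> 0" "e \<longlonglongrightarrow> 0"
    using V_e_tendsto_zero[of p] gap[OF p] by blast+
  from tendsto_scaleR[OF tendsto_const tendsto_diff[OF this], of "1 / \<gamma>"]
  have "(\<lambda>k. F (z k) + \<zeta> k) \<longlonglongrightarrow> 0"
    using \<gamma> by (simp add: V_minus_e)
  from LIMSEQ_Suc[OF LIMSEQ_subseq_LIMSEQ[OF this r]]
  have "(\<lambda>k. F (z (r (Suc k))) + \<zeta> (r (Suc k))) \<longlonglongrightarrow> 0"
    by (simp add: o_def)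
  from tendsto_diff[OF this F_lim] have \<zeta>_lim: "(\<lambda>k. \<zeta> (r (Suc k))) \<longlonglongrightarrow> - F x"
    by simp
  \<comment> \<open>The graph of N_C is closed: the normal inequality for \<zeta> at z passes to the
    limit along the subsequence.\<close>
  have "(v - x) \<bullet> (- F x) \<le> 0" if "v \<in> C" for v
  proof (rule LIMSEQ_le_const2)
    show "(\<lambda>k. (v - z (r (Suc k))) \<bullet> \<zeta> (r (Suc k))) \<longlonglongrightarrow> (v - x) \<bullet> (- F x)"
      by (intro tendsto_intros x' \<zeta>_lim)
    show "\<exists>N. \<forall>k\<ge>N. (v - z (r (Suc k))) \<bullet> \<zeta> (r (Suc k)) \<le> 0"
      using normal[OF r1] z_in_C[OF r1] that by (simp add: normal_cone_def)
  qed
  then have sol: "x \<in> VI_solutions F C"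
    using x_in_C by (auto simp: VI_solutions_def inner_commute)
  \<comment> \<open>The cluster point is itself a solution, so the whole sequence of distances to it
    converges; the subsequence identifies the limit as 0.\<close>
  obtain l where l: "(\<lambda>k. (norm (z k - x))\<^sup>2) \<longlonglongrightarrow> l"
    using distance_convergent[of x] gap[OF sol] by (auto simp: convergent_def)
  have "(\<lambda>k. (norm (z (r (Suc k)) - x))\<^sup>2) \<longlonglongrightarrow> (norm (x - x))\<^sup>2"
    by (intro tendsto_intros x')
  moreover have "(\<lambda>k. (norm (z (r (Suc k)) - x))\<^sup>2) \<longlonglongrightarrow> l"
    using LIMSEQ_Suc[OF LIMSEQ_subseq_LIMSEQ[OF l r]] by (simp add: o_def)
  ultimately have "(norm (x - x))\<^sup>2 = l"
    by (rule LIMSEQ_unique)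
  then have "l = 0" by simp
  with tendsto_real_sqrt[OF l] have "(\<lambda>k. norm (z k - x)) \<longlonglongrightarrow> 0" by simp
  then have "z \<longlonglongrightarrow> x"
    by (simp add: tendsto_norm_zero_iff LIM_zero_iff)
  with sol show ?thesis by blast
qed

end
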